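(* Let $G=(V,E)$ be a directed graph with distinct vertices $s,t\in V$ such that $t$ is reachable from $s$, all edges having unit capacity. Then every ordering of $E$ produced by $\textsc{Quickest-Increment}$ is $2$-competitive, i.e. $f(S^{*}_{k})\leq2f(S^{\mathrm{A}}_{k})$ for all $k\in\{1,\dots,|E|\}$.
   Context: For $X\subseteq E$, $f(X)$ is the maximum value of an $s$-$t$-flow in $(V,X)$ with unit edge capacities. For $k\in\{1,\dots,|E|\}$, $S^{*}_{k}$ denotes a set $X\subseteq E$ with $|X|\leq k$ maximizing $f(X)$. Algorithm $\textsc{Quickest-Increment}$: it first appends the edges of a shortest (fewest edges) $s$-$t$-path, then repeatedly appends (in arbitrary order) a minimum-cardinality set of not yet chosen edges whose addition increases the maximum flow value of the chosen edge set by at least $1$, until the maximum flow value of $G$ is reached; remaining edges are appended arbitrarily. $S^{\mathrm{A}}_{k}$ denotes the set of the first $k$ edges of the resulting ordering. *)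

theory Defs
  imports Complex_Main "Graph_Theory.Arc_Walk"
begin

definition st_flow :: "('a, 'b) pre_digraph \<Rightarrow> 'a \<Rightarrow> 'a \<Rightarrow> ('b \<Rightarrow> real) \<Rightarrow> bool" where
  "st_flow H s t \<phi> \<longleftrightarrow>
     (\<forall>e \<in> arcs H. 0 \<le> \<phi> e \<and> \<phi> e \<le> 1) \<and>
     (\<forall>v \<in> verts H - {s, t}. (\<Sum>e\<in>in_arcs H v. \<phi> e) = (\<Sum>e\<in>out_arcs H v. \<phi> e))"

definition flow_value :: "('a, 'b) pre_digraph \<Rightarrow> 'a \<Rightarrow> ('b \<Rightarrow> real) \<Rightarrow> real" where
  "flow_value H s \<phi> = (\<Sum>e\<in>out_arcs H s. \<phi> e) - (\<Sum>e\<in>in_arcs H s. \<phi> e)"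

text \<open>The supremum below is over a nonempty set (zero flow) that is bounded by the number of
  arcs if \<^term>\<open>X\<close> is finite; by compactness it is then attained.\<close>

definition max_flow :: "('a, 'b) pre_digraph \<Rightarrow> 'a \<Rightarrow> 'a \<Rightarrow> 'b set \<Rightarrow> real" where
  "max_flow G s t X =
     (SUP \<phi> \<in> {\<phi>. st_flow (G\<lparr>arcs := X\<rparr>) s t \<phi>}. flow_value (G\<lparr>arcs := X\<rparr>) s \<phi>)"

definition optimal_set :: "('a, 'b) pre_digraph \<Rightarrow> 'a \<Rightarrow> 'a \<Rightarrow> nat \<Rightarrow> 'b set \<Rightarrow> bool" where
  "optimal_set G s t k X \<longleftrightarrow>
     X \<subseteq> arcs G \<and> card X \<le> k \<and>
     (\<forall>Y. Y \<subseteq> arcs G \<and> card Y \<le> k \<longrightarrow> max_flow G s t Y \<le> max_flow G s t X)"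

definition shortest_path :: "('a, 'b) pre_digraph \<Rightarrow> 'a \<Rightarrow> 'a \<Rightarrow> 'b list \<Rightarrow> bool" where
  "shortest_path G s t p \<longleftrightarrow>
     pre_digraph.apath G s p t \<and> (\<forall>q. pre_digraph.apath G s q t \<longrightarrow> length p \<le> length q)"

definition increment :: "('a, 'b) pre_digraph \<Rightarrow> 'a \<Rightarrow> 'a \<Rightarrow> 'b set \<Rightarrow> 'b set \<Rightarrow> bool" where
  "increment G s t X D \<longleftrightarrow>
     D \<subseteq> arcs G - X \<and> max_flow G s t (X \<union> D) \<ge> max_flow G s t X + 1"

definition quickest_increment :: "('a, 'b) pre_digraph \<Rightarrow> 'a \<Rightarrow> 'a \<Rightarrow> 'b set \<Rightarrow> 'b set \<Rightarrow> bool" where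
  "quickest_increment G s t X D \<longleftrightarrow>
     increment G s t X D \<and> (\<forall>D'. increment G s t X D' \<longrightarrow> card D \<le> card D')"

text \<open>The possible lists of chosen arcs after the initial path and any number of increments.
  Each newly chosen set is appended in an arbitrary order.\<close>

inductive qi_run :: "('a, 'b) pre_digraph \<Rightarrow> 'a \<Rightarrow> 'a \<Rightarrow> 'b list \<Rightarrow> bool"
  for G s t where
  path: "shortest_path G s t p \<Longrightarrow> set xs = set p \<Longrightarrow> distinct xs \<Longrightarrow> qi_run G s t xs"
| increment: "qi_run G s t xs \<Longrightarrow> max_flow G s t (set xs) < max_flow G s t (arcs G) \<Longrightarrow>
    quickest_increment G s t (set xs) D \<Longrightarrow> set ds = D \<Longrightarrow> distinct ds \<Longrightarrow>
    qi_run G s t (xs @ ds)"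

definition qi_ordering :: "('a, 'b) pre_digraph \<Rightarrow> 'a \<Rightarrow> 'a \<Rightarrow> 'b list \<Rightarrow> bool" where
  "qi_ordering G s t es \<longleftrightarrow>
     distinct es \<and> set es = arcs G \<and>
     (\<exists>xs ys. es = xs @ ys \<and> qi_run G s t xs \<and>
        max_flow G s t (set xs) = max_flow G s t (arcs G))"

end

theory Submission
  imports Defs
begin

text \<open>Let \<open>\<delta>(X)\<close> be the size of a quickest increment of \<open>X\<close>. If \<open>X \<subseteq> Y\<close> and
  \<open>m = f(Y) - f(X) \<ge> 1\<close>, then \<open>m \<cdot> \<delta>(X) \<le> |Y - X|\<close>: moving from a maximum flow for \<open>X\<close> a
  fraction \<open>1/m\<close> of the way to one for \<open>Y\<close> gives value \<open>f(X) + 1\<close>, with total load at most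
  \<open>|Y - X| / m\<close> on the arcs outside \<open>X\<close>, and flows can be rounded to integral ones without
  increasing a given linear cost. Consequently quickest increments raise the flow value by exactly 1
  and their sizes never decrease, so the algorithm has spent at most \<open>(j + 1) \<cdot> \<delta>(X)\<close> arcs after
  incrementing the set \<open>X\<close> of flow value \<open>j\<close>. On the other hand, a set \<open>S\<close> with
  \<open>f(S) \<ge> 2 j + 1\<close> satisfies \<open>(j + 1) \<cdot> \<delta>(X) \<le> |S - X|\<close> and thus is at least as large.\<close>

section \<open>Rounding of fractional circulations\<close>

text \<open>Gaussian elimination by induction on the equations: solve equation \<open>i\<close> for
  a variable with non-zero coefficient and substitute the result into the others.\<close>

lemma homogeneous_system_nontrivial_solution:
  fixes a :: "'i \<Rightarrow> 'e \<Rightarrow> real"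
  assumes "finite I" "finite E" "card I < card E"
  shows "\<exists>z. (\<forall>e. e \<notin> E \<longrightarrow> z e = 0) \<and> (\<exists>e\<in>E. z e \<noteq> 0) \<and> (\<forall>i\<in>I. (\<Sum>e\<in>E. a i e * z e) = 0)"
  using assms
proof (induction I arbitrary: E a rule: finite_induct)
  case empty
  then obtain e where "e \<in> E" by fastforce
  then show ?case by (intro exI[of _ "\<lambda>x. if x = e then 1 else 0"]) auto
next
  case (insert i I)
  show ?case
  proof (cases "\<forall>e\<in>E. a i e = 0")
    case True
    have "card I < card E" using insert by simp
    from insert.IH[OF insert.prems(1) this, of a] True show ?thesis by auto
  next
    case False
    then obtain f where f: "f \<in> E" "a i f \<noteq> 0" by blast
    let ?E = "E - {f}"
    let ?b = "\<lambda>j e. a j e - a j f * a i e / a i f"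
    have "card I < card ?E" using insert f by simp
    with insert.IH[of ?E ?b] insert.prems(1) obtain z where
      z: "\<And>e. e \<notin> ?E \<Longrightarrow> z e = 0" "\<exists>e\<in>?E. z e \<noteq> 0"
        "\<And>j. j \<in> I \<Longrightarrow> (\<Sum>e\<in>?E. ?b j e * z e) = 0"
      by auto
    \<comment> \<open>The value at \<open>f\<close> is forced by equation \<open>i\<close>;
      \<open>?b\<close> holds the coefficients of the other equations after \<open>f\<close> has
      been eliminated.\<close>
    define y where "y = z(f := - (\<Sum>e\<in>?E. a i e * z e) / a i f)"
    have split: "(\<Sum>e\<in>E. a j e * y e) = a j f * y f + (\<Sum>e\<in>?E. a j e * z e)" for j
      using f insert.prems(1) by (simp add: sum.remove y_def)
    have "(\<Sum>e\<in>E. a i e * y e) = 0"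
      unfolding split using f by (simp add: y_def)
    moreover have "(\<Sum>e\<in>E. a j e * y e) = 0" if "j \<in> I" for j
    proof -
      have "0 = (\<Sum>e\<in>?E. a j e * z e - a j f / a i f * (a i e * z e))"
        unfolding z(3)[OF that, symmetric] by (intro sum.cong) (auto simp: algebra_simps)
      also have "\<dots> = (\<Sum>e\<in>?E. a j e * z e) - a j f / a i f * (\<Sum>e\<in>?E. a i e * z e)"
        by (simp add: sum_subtractf sum_distrib_left)
      finally show ?thesis unfolding split by (simp add: y_def)
    qed
    moreover have "\<forall>e. e \<notin> E \<longrightarrow> y e = 0" "\<exists>e\<in>E. y e \<noteq> 0"
      using z(1,2) f by (auto simp: y_def)
    ultimately show ?thesis by blast
  qed
qed

text \<open>Arbitrary \<open>src\<close> and \<open>dst\<close> instead of a digraph, because the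
  rounding of flows adds an artificial return arc. Loops cancel out.\<close>

definition net_out :: "('e \<Rightarrow> 'v) \<Rightarrow> ('e \<Rightarrow> 'v) \<Rightarrow> 'e set \<Rightarrow> ('e \<Rightarrow> real) \<Rightarrow> 'v \<Rightarrow> real" where
  "net_out src dst A x v = (\<Sum>e\<in>A. (of_bool (src e = v) - of_bool (dst e = v)) * x e)"

lemma net_out_lincomb:
  "net_out src dst A (\<lambda>e. a * x e + b * y e) v = a * net_out src dst A x v + b * net_out src dst A y v"
  unfolding net_out_def sum_distrib_left sum.distrib[symmetric]
  by (intro sum.cong) (simp_all add: algebra_simps)

lemma sum_net_out:
  assumes "finite V"
  shows "(\<Sum>v\<in>V. net_out src dst A x v) = (\<Sum>e\<in>A. (of_bool (src e \<in> V) - of_bool (dst e \<in> V)) * x e)"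
proof -
  have "(\<Sum>v\<in>V. (of_bool (u = v) :: real)) = of_bool (u \<in> V)" for u
    using assms by (simp add: of_bool_def)
  then show ?thesis
    unfolding net_out_def
    by (subst sum.swap) (simp add: sum_distrib_right[symmetric] sum_subtractf)
qed

lemma sum_net_out_eq_0:
  assumes "finite V" "\<And>e. e \<in> A \<Longrightarrow> src e \<in> V \<and> dst e \<in> V"
  shows "(\<Sum>v\<in>V. net_out src dst A x v) = 0"
  unfolding sum_net_out[OF assms(1)] using assms(2) by simp

text \<open>Double counting gives at most as many vertices as arcs, and one of the conservation
  constraints is redundant.\<close>

lemma nontrivial_circulation_of_min_degree_2:
  assumes F: "finite F" "F \<noteq> {}"
    and deg: "\<And>e v. e \<in> F \<Longrightarrow> src e \<noteq> dst e \<Longrightarrow> v \<in> {src e, dst e} \<Longrightarrow>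
      \<exists>e'\<in>F. e' \<noteq> e \<and> v \<in> {src e', dst e'}"
  shows "\<exists>z. (\<forall>e. e \<notin> F \<longrightarrow> z e = 0) \<and> (\<exists>e\<in>F. z e \<noteq> 0) \<and> (\<forall>v. net_out src dst F z v = 0)"
proof (cases "\<exists>e\<in>F. src e = dst e")
  case True
  then obtain e where e: "e \<in> F" "src e = dst e" by blast
  \<comment> \<open>Unit load on a loop is itself a circulation. Once loops are excluded,
    \<open>deg\<close> applies at both ends of every arc.\<close>
  have "net_out src dst F (\<lambda>x. if x = e then 1 else 0) v = 0" for v
    unfolding net_out_def using e(2) by (intro sum.neutral) auto
  with e show ?thesis by (intro exI[of _ "\<lambda>x. if x = e then 1 else 0"]) auto
next
  case False
  define V where "V = src ` F \<union> dst ` F"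
  have V: "finite V" using F by (simp add: V_def)
  obtain v0 where v0: "v0 \<in> V" using F by (auto simp: V_def)
  have two: "2 \<le> card {e\<in>F. v \<in> {src e, dst e}}" if "v \<in> V" for v
  proof -
    from that obtain e where e: "e \<in> F" "v \<in> {src e, dst e}" by (auto simp: V_def)
    with deg[OF e(1) _ e(2)] False obtain e' where "e' \<in> F" "e' \<noteq> e" "v \<in> {src e', dst e'}" by blast
    with e have "card {e, e'} = 2" "{e, e'} \<subseteq> {e\<in>F. v \<in> {src e, dst e}}" by auto
    then show ?thesis using card_mono[of "{e\<in>F. v \<in> {src e, dst e}}" "{e, e'}"] F(1) by simp
  qed
  have "2 * card V = (\<Sum>v\<in>V. 2)" by simp
  also have "\<dots> \<le> (\<Sum>v\<in>V. card {e\<in>F. v \<in> {src e, dst e}})" by (intro sum_mono two)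
  also have "\<dots> = (\<Sum>e\<in>F. card {v\<in>V. v \<in> {src e, dst e}})"
    using F(1) V by (intro sum_multicount_gen) auto
  also have "\<dots> = (\<Sum>e\<in>F. card {src e, dst e})"
    by (intro sum.cong refl arg_cong[where f = card]) (auto simp: V_def)
  also have "\<dots> \<le> (\<Sum>e\<in>F. 2)" by (intro sum_mono) (simp add: card_insert_if)
  finally have "card V \<le> card F" by simp
  then have "card (V - {v0}) < card F"
    using v0 V by (metis card_Diff1_less le_trans not_le)
  from homogeneous_system_nontrivial_solution[OF _ F(1) this,
      of "\<lambda>v e. of_bool (src e = v) - of_bool (dst e = v)"] V
  obtain z where z: "\<And>e. e \<notin> F \<Longrightarrow> z e = 0" "\<exists>e\<in>F. z e \<noteq> 0"
    "\<And>v. v \<in> V - {v0} \<Longrightarrow> net_out src dst F z v = 0"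
    unfolding net_out_def by auto
  have "(\<Sum>v\<in>V. net_out src dst F z v) = 0"
    by (rule sum_net_out_eq_0[OF V]) (auto simp: V_def)
  then have "net_out src dst F z v0 = 0"
    using z(3) V v0 by (simp add: sum.remove)
  moreover have "net_out src dst F z v = 0" if "v \<notin> V" for v
    unfolding net_out_def using that by (intro sum.neutral) (auto simp: V_def)
  ultimately have "\<forall>v. net_out src dst F z v = 0" using z(3) by (metis Diff_iff singletonD)
  with z show ?thesis by blast
qed

text \<open>If \<open>e\<close> were the only fractional arc at \<open>v\<close>, the other terms of
  the conservation equation would add up to an integer, and so \<open>x e\<close> would be one too.
  This supplies \<open>deg\<close> above for the set of fractional arcs.\<close>

lemma fractional_support_min_degree_2:
  assumes A: "finite A" and circ: "net_out src dst A x v = 0"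
    and e: "e \<in> A" "x e \<notin> \<int>" "src e \<noteq> dst e" "v \<in> {src e, dst e}"
  shows "\<exists>e'\<in>A. x e' \<notin> \<int> \<and> e' \<noteq> e \<and> v \<in> {src e', dst e'}"
proof (rule ccontr)
  assume not: "\<not> ?thesis"
  let ?c = "\<lambda>e. of_bool (src e = v) - of_bool (dst e = v) :: real"
  have "?c e' * x e' \<in> \<int>" if "e' \<in> A - {e}" for e'
    using not that by (cases "v \<in> {src e', dst e'}") (auto intro!: Ints_mult Ints_diff)
  then have "(\<Sum>e'\<in>A - {e}. ?c e' * x e') \<in> \<int>" by (intro Ints_sum)
  moreover have "?c e * x e = - (\<Sum>e'\<in>A - {e}. ?c e' * x e')"
    using circ A e(1) by (simp add: net_out_def sum.remove)
  ultimately have "?c e * x e \<in> \<int>" by simp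
  moreover have "?c e * x e = x e \<or> ?c e * x e = - x e" using e(3,4) by auto
  ultimately show False using e(2) by (metis Ints_minus minus_minus)
qed

text \<open>Move from \<open>x\<close> along \<open>z\<close> until some moving coordinate hits the
  integer bound ahead of it; stopping at the first hit keeps all others within their bounds.\<close>

lemma step_to_integral_coordinate:
  fixes x z :: "'e \<Rightarrow> real"
  assumes F: "finite F" and z: "\<exists>e\<in>F. z e \<noteq> 0"
  shows "\<exists>r\<ge>0. (\<forall>e\<in>F. \<lfloor>x e\<rfloor> \<le> x e + r * z e \<and> x e + r * z e \<le> \<lceil>x e\<rceil>) \<and>
    (\<exists>e\<in>F. x e + r * z e \<in> \<int>)"
proof -
  \<comment> \<open>For \<open>z e \<noteq> 0\<close>, this is the step length at which coordinate
    \<open>e\<close> hits its bound.\<close>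
  define g where "g e = (if z e > 0 then (\<lceil>x e\<rceil> - x e) / z e else (\<lfloor>x e\<rfloor> - x e) / z e)" for e
  let ?S = "{e\<in>F. z e \<noteq> 0}"
  have S: "finite ?S" "?S \<noteq> {}" using F z by auto
  define r where "r = Min (g ` ?S)"
  have "r \<in> g ` ?S" unfolding r_def using S by (intro Min_in) auto
  then obtain f where f: "f \<in> F" "z f \<noteq> 0" "r = g f" by auto
  have g0: "0 \<le> g e" for e
    by (cases "z e = 0") (auto simp: g_def divide_nonpos_neg divide_nonpos_nonpos)
  have r0: "0 \<le> r" using g0 f(3) by simp
  have le: "r \<le> g e" if "e \<in> F" "z e \<noteq> 0" for e
    unfolding r_def using S that by (intro Min_le) auto
  have "\<lfloor>x e\<rfloor> \<le> x e + r * z e \<and> x e + r * z e \<le> \<lceil>x e\<rceil>" if "e \<in> F" for e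
  proof -
    consider "z e = 0" | "z e > 0" | "z e < 0" by linarith
    then show ?thesis
    proof cases
      case 2
      then have "r * z e \<le> \<lceil>x e\<rceil> - x e"
        using le[OF that] by (simp add: g_def field_simps)
      moreover have "0 \<le> r * z e" using 2 r0 by simp
      ultimately show ?thesis by (auto intro: order_trans[of _ "x e"])
    next
      case 3
      then have "r * z e \<ge> \<lfloor>x e\<rfloor> - x e"
        using le[OF that] by (simp add: g_def field_simps)
      moreover have "r * z e \<le> 0" using 3 r0 by (simp add: mult_nonneg_nonpos)
      ultimately show ?thesis by (auto intro: order_trans[of _ "x e"])
    qed auto
  qed
  moreover have "x f + r * z f \<in> \<int>" using f by (auto simp: g_def)
  ultimately show ?thesis using r0 f(1) by blast
qed

text \<open>Induction on the number of fractional arcs. They carry a non-zero circulation; shifting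
  along it, in a direction of non-increasing cost, makes a further arc integral and leaves integral
  arcs unchanged.\<close>

lemma circulation_rounding:
  fixes x c :: "'e \<Rightarrow> real"
  assumes "finite A" "\<And>v. net_out src dst A x v = 0"
  shows "\<exists>y :: 'e \<Rightarrow> real. (\<forall>v. net_out src dst A y v = 0) \<and>
    (\<forall>e\<in>A. y e \<in> \<int> \<and> \<lfloor>x e\<rfloor> \<le> y e \<and> y e \<le> \<lceil>x e\<rceil>) \<and> (\<Sum>e\<in>A. c e * y e) \<le> (\<Sum>e\<in>A. c e * x e)"
  using assms(2)
proof (induction "card {e\<in>A. x e \<notin> \<int>}" arbitrary: x rule: less_induct)
  case less
  define F where "F = {e\<in>A. x e \<notin> \<int>}"
  have F: "finite F" "F \<subseteq> A" using assms(1) by (auto simp: F_def)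
  show ?case
  proof (cases "F = {}")
    case True
    then have "\<forall>e\<in>A. x e \<in> \<int>" by (auto simp: F_def)
    with less.prems show ?thesis by (intro exI[of _ x]) auto
  next
    case False
    have "\<exists>e'\<in>F. e' \<noteq> e \<and> v \<in> {src e', dst e'}"
      if "e \<in> F" "src e \<noteq> dst e" "v \<in> {src e, dst e}" for e v
      using fractional_support_min_degree_2[OF assms(1) less.prems[of v], of e] that
      by (auto simp: F_def)
    from nontrivial_circulation_of_min_degree_2[OF F(1) False this]
    obtain z0 where z0: "\<And>e. e \<notin> F \<Longrightarrow> z0 e = 0" "\<exists>e\<in>F. z0 e \<noteq> 0" "\<And>v. net_out src dst F z0 v = 0"
      by blast
    have "net_out src dst A z0 v = 0" for v
      using z0(1) z0(3)[of v] F assms(1) unfolding net_out_def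
      by (subst sum.mono_neutral_right[of A F]) auto
    \<comment> \<open>If \<open>z0\<close> has positive cost, its negative has negative
      cost.\<close>
    with z0 have "\<exists>z. (\<forall>e. e \<notin> F \<longrightarrow> z e = 0) \<and> (\<exists>e\<in>F. z e \<noteq> 0) \<and> (\<forall>v. net_out src dst A z v = 0)
        \<and> (\<Sum>e\<in>A. c e * z e) \<le> 0"
      by (cases "(\<Sum>e\<in>A. c e * z0 e) \<le> 0",
          blast, intro exI[of _ "\<lambda>e. - z0 e"]) (auto simp: net_out_def sum_negf)
    then obtain z where z: "\<And>e. e \<notin> F \<Longrightarrow> z e = 0" "\<exists>e\<in>F. z e \<noteq> 0"
      "\<And>v. net_out src dst A z v = 0" "(\<Sum>e\<in>A. c e * z e) \<le> 0"
      by blast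
    from step_to_integral_coordinate[OF F(1) z(2), of x] obtain r where
      r: "r \<ge> 0" "\<And>e. e \<in> F \<Longrightarrow> \<lfloor>x e\<rfloor> \<le> x e + r * z e \<and> x e + r * z e \<le> \<lceil>x e\<rceil>"
        "\<exists>e\<in>F. x e + r * z e \<in> \<int>"
      by (auto simp: F_def)
    define y where "y e = x e + r * z e" for e
    have bounds: "\<lfloor>x e\<rfloor> \<le> y e \<and> y e \<le> \<lceil>x e\<rceil>" for e
      using r(2)[of e] z(1)[of e] by (cases "e \<in> F") (auto simp: y_def)
    have "{e\<in>A. y e \<notin> \<int>} \<subset> F"
      using r(3) z(1) by (auto simp: y_def F_def)
    then have "card {e\<in>A. y e \<notin> \<int>} < card {e\<in>A. x e \<notin> \<int>}"
      using F(1) by (auto simp: F_def intro: psubset_card_mono)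
    moreover have "net_out src dst A y v = 0" for v
      using net_out_lincomb[of src dst A 1 x r z v] less.prems[of v] z(3)[of v]
      by (simp add: y_def[abs_def])
    ultimately obtain w :: "'e \<Rightarrow> real" where w: "\<And>v. net_out src dst A w v = 0"
      "\<And>e. e \<in> A \<Longrightarrow> w e \<in> \<int> \<and> \<lfloor>y e\<rfloor> \<le> w e \<and> w e \<le> \<lceil>y e\<rceil>"
      "(\<Sum>e\<in>A. c e * w e) \<le> (\<Sum>e\<in>A. c e * y e)"
      using less.hyps[of y] by blast
    have "(\<Sum>e\<in>A. c e * y e) = (\<Sum>e\<in>A. c e * x e) + r * (\<Sum>e\<in>A. c e * z e)"
      by (simp add: y_def algebra_simps sum.distrib sum_distrib_left)
    with w(3) r(1) z(4) have "(\<Sum>e\<in>A. c e * w e) \<le> (\<Sum>e\<in>A. c e * x e)"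
      using mult_nonneg_nonpos[of r "\<Sum>e\<in>A. c e * z e"] by linarith
    \<comment> \<open>The induction hypothesis bounds \<open>w\<close> by floor and ceiling of
      \<open>y\<close>, which lie between those of \<open>x\<close> because \<open>y\<close>
      does.\<close>
    moreover have "\<lfloor>x e\<rfloor> \<le> w e \<and> w e \<le> \<lceil>x e\<rceil>" if "e \<in> A" for e
    proof -
      have "\<lfloor>x e\<rfloor> \<le> \<lfloor>y e\<rfloor>" "\<lceil>y e\<rceil> \<le> \<lceil>x e\<rceil>"
        using bounds[of e] by (auto simp: le_floor_iff ceiling_le_iff)
      then have "real_of_int \<lfloor>x e\<rfloor> \<le> \<lfloor>y e\<rfloor>" "real_of_int \<lceil>y e\<rceil> \<le> \<lceil>x e\<rceil>" by simp_all
      with w(2)[OF that] show ?thesis by linarith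
    qed
    ultimately show ?thesis using w(1,2) by blast
  qed
qed

section \<open>Flows with unit capacities\<close>

locale st_network = fin_digraph G for G :: "('a, 'b) pre_digraph" +
  fixes s t :: 'a
  assumes s_in_verts: "s \<in> verts G" and t_in_verts: "t \<in> verts G" and s_neq_t: "s \<noteq> t"
begin

abbreviation excess :: "('b \<Rightarrow> real) \<Rightarrow> 'a \<Rightarrow> real" where
  "excess \<equiv> net_out (tail G) (head G) (arcs G)"

abbreviation mf :: "'b set \<Rightarrow> real" where
  "mf \<equiv> max_flow G s t"

text \<open>Flows in \<open>(V, X)\<close> are regarded as flows in \<open>G\<close> that vanish outside \<open>X\<close>, so that
  flows for different arc sets can be combined linearly.\<close>

definition flow_on :: "'b set \<Rightarrow> ('b \<Rightarrow> real) \<Rightarrow> bool" where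
  "flow_on X \<phi> \<longleftrightarrow> (\<forall>e. 0 \<le> \<phi> e \<and> \<phi> e \<le> of_bool (e \<in> X)) \<and>
    (\<forall>v \<in> verts G - {s, t}. excess \<phi> v = 0)"

lemma flow_onD:
  assumes "flow_on X \<phi>"
  shows "0 \<le> \<phi> e" "\<phi> e \<le> 1" "e \<notin> X \<Longrightarrow> \<phi> e = 0"
proof -
  have *: "0 \<le> \<phi> e" "\<phi> e \<le> of_bool (e \<in> X)" using assms by (auto simp: flow_on_def)
  then show "0 \<le> \<phi> e" "\<phi> e \<le> 1" by (auto simp: of_bool_def split: if_splits)
  show "e \<notin> X \<Longrightarrow> \<phi> e = 0" using * by simp
qed

lemma flow_on_mono: "flow_on X \<phi> \<Longrightarrow> X \<subseteq> Y \<Longrightarrow> flow_on Y \<phi>"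
  unfolding flow_on_def by (auto simp: of_bool_def split: if_splits)

lemma flow_on_convex:
  assumes "flow_on X \<phi>" "flow_on X \<psi>" "0 \<le> r" "r \<le> 1"
  shows "flow_on X (\<lambda>e. (1 - r) * \<phi> e + r * \<psi> e)"
proof -
  have "(1 - r) * \<phi> e + r * \<psi> e \<le> (1 - r) * of_bool (e \<in> X) + r * of_bool (e \<in> X)" for e
    using assms by (intro add_mono mult_left_mono) (auto simp: flow_on_def)
  then have "(1 - r) * \<phi> e + r * \<psi> e \<le> of_bool (e \<in> X)" for e
    by (simp add: distrib_right[symmetric])
  moreover have "0 \<le> (1 - r) * \<phi> e + r * \<psi> e" for e
    using assms flow_onD(1)[of X] by (intro add_nonneg_nonneg mult_nonneg_nonneg) auto
  ultimately show ?thesis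
    using assms by (simp add: flow_on_def net_out_lincomb)
qed

lemma excess_outside_verts: "v \<notin> verts G \<Longrightarrow> excess \<phi> v = 0"
  unfolding net_out_def by (intro sum.neutral) (auto simp: wellformed)

text \<open>The net outflows of all vertices add up to zero, and only \<open>s\<close> and
  \<open>t\<close> can contribute.\<close>

lemma excess_sink:
  assumes "flow_on X \<phi>"
  shows "excess \<phi> t = - excess \<phi> s"
proof -
  have "0 = (\<Sum>v\<in>verts G. excess \<phi> v)"
    by (rule sum_net_out_eq_0[symmetric]) (auto simp: wellformed)
  also have "\<dots> = (\<Sum>v\<in>{s, t}. excess \<phi> v)"
    using assms s_in_verts t_in_verts by (intro sum.mono_neutral_right) (auto simp: flow_on_def)
  finally show ?thesis using s_neq_t by simp
qed

lemma net_out_restrict: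
  assumes "X \<subseteq> arcs G"
  shows "net_out (tail G) (head G) X \<phi> v = excess (\<lambda>e. of_bool (e \<in> X) * \<phi> e) v"
  unfolding net_out_def using assms by (intro sum.mono_neutral_cong_left) auto

lemma out_arcs_minus_in_arcs:
  assumes "X \<subseteq> arcs G"
  shows "(\<Sum>e\<in>out_arcs (G\<lparr>arcs := X\<rparr>) v. \<phi> e) - (\<Sum>e\<in>in_arcs (G\<lparr>arcs := X\<rparr>) v. \<phi> e)
    = net_out (tail G) (head G) X \<phi> v"
proof -
  have X: "finite X" using assms finite_arcs by (rule finite_subset)
  show ?thesis
    by (simp add: net_out_def out_arcs_def in_arcs_def left_diff_distrib sum_subtractf X
        sum.If_cases Int_def of_bool_def if_distrib[where f = "\<lambda>x. x * _"] cong: if_cong)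
qed

lemma st_flow_iff_flow_on:
  assumes "X \<subseteq> arcs G"
  shows "st_flow (G\<lparr>arcs := X\<rparr>) s t \<phi> \<longleftrightarrow> flow_on X (\<lambda>e. of_bool (e \<in> X) * \<phi> e)"
proof -
  have "sum \<phi> (in_arcs (G\<lparr>arcs := X\<rparr>) v) = sum \<phi> (out_arcs (G\<lparr>arcs := X\<rparr>) v) \<longleftrightarrow>
      excess (\<lambda>e. of_bool (e \<in> X) * \<phi> e) v = 0" for v
    using out_arcs_minus_in_arcs[OF assms, of \<phi> v] net_out_restrict[OF assms, of \<phi> v] by linarith
  moreover have "(\<forall>e\<in>X. 0 \<le> \<phi> e \<and> \<phi> e \<le> 1) \<longleftrightarrow>
      (\<forall>e. 0 \<le> of_bool (e \<in> X) * \<phi> e \<and> of_bool (e \<in> X) * \<phi> e \<le> of_bool (e \<in> X))"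
    by (auto simp: of_bool_def)
  ultimately show ?thesis by (simp add: st_flow_def flow_on_def)
qed

text \<open>\<open>st_flow\<close> ignores values outside \<open>X\<close>. Truncating them to zero
  maps the flows in \<open>(V, X)\<close> onto those of \<open>flow_on\<close> and keeps the value,
  so both suprema coincide.\<close>

lemma max_flow_eq_SUP:
  assumes "X \<subseteq> arcs G"
  shows "mf X = (SUP \<phi> \<in> {\<phi>. flow_on X \<phi>}. excess \<phi> s)"
proof -
  let ?r = "\<lambda>\<phi> e. of_bool (e \<in> X) * \<phi> e :: real"
  have r: "?r \<phi> = \<phi>" if "flow_on X \<phi>" for \<phi>
    using flow_onD(3)[OF that] by (intro ext) auto
  have "{\<phi>. flow_on X \<phi>} = ?r ` {\<phi>. st_flow (G\<lparr>arcs := X\<rparr>) s t \<phi>}" (is "?A = ?B")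
  proof
    show "?B \<subseteq> ?A" using assms by (auto simp: st_flow_iff_flow_on)
    show "?A \<subseteq> ?B"
    proof
      fix \<phi> assume "\<phi> \<in> ?A"
      with r[of \<phi>] have "st_flow (G\<lparr>arcs := X\<rparr>) s t \<phi>" "\<phi> = ?r \<phi>"
        by (simp_all add: st_flow_iff_flow_on assms)
      then show "\<phi> \<in> ?B" by blast
    qed
  qed
  then show ?thesis
    unfolding max_flow_def flow_value_def out_arcs_minus_in_arcs[OF assms]
      net_out_restrict[OF assms] by (simp add: image_image)
qed

text \<open>Bounds the flow values, so that the supremum in \<open>max_flow\<close> is a genuine
  least upper bound.\<close>

lemma excess_le_card:
  assumes "X \<subseteq> arcs G" "flow_on X \<phi>"
  shows "excess \<phi> s \<le> card X"
proof -
  have "excess \<phi> s \<le> (\<Sum>e\<in>arcs G. of_bool (e \<in> X))"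
    unfolding net_out_def
  proof (rule sum_mono)
    fix e
    have "0 \<le> \<phi> e" "\<phi> e \<le> of_bool (e \<in> X)" using assms(2) by (auto simp: flow_on_def)
    then show "(of_bool (tail G e = s) - of_bool (head G e = s)) * \<phi> e \<le> of_bool (e \<in> X)"
      by (cases "tail G e = s"; cases "head G e = s") auto
  qed
  also have "\<dots> = card X" using assms(1) by (simp add: of_bool_def sum.If_cases inf.absorb2)
  finally show ?thesis .
qed

lemma excess_le_max_flow:
  assumes "X \<subseteq> arcs G" "flow_on X \<phi>"
  shows "excess \<phi> s \<le> mf X"
  unfolding max_flow_eq_SUP[OF assms(1)] using assms
  by (intro cSUP_upper) (auto intro!: bdd_aboveI2 excess_le_card)

text \<open>An integral flow under unit capacities is the indicator of an arc set \<open>Z\<close>.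
  The value is rounded as well, being the load on the return arc. \<open>w\<close> prices the arcs
  and \<open>w0\<close> the value: \<open>w = 0\<close> with \<open>w0 = -1\<close> forbids a loss
  of value, and \<open>w0 = 0\<close> controls the arc cost alone.\<close>

lemma flow_rounding:
  fixes w :: "'b \<Rightarrow> real" and w0 :: real
  assumes "X \<subseteq> arcs G" "flow_on X \<phi>"
  obtains Z where "Z \<subseteq> X" "flow_on Z (\<lambda>e. of_bool (e \<in> Z))"
    "excess (\<lambda>e. of_bool (e \<in> Z)) s \<in> \<int>"
    "\<lfloor>excess \<phi> s\<rfloor> \<le> excess (\<lambda>e. of_bool (e \<in> Z)) s"
    "excess (\<lambda>e. of_bool (e \<in> Z)) s \<le> \<lceil>excess \<phi> s\<rceil>"
    "(\<Sum>e\<in>Z. w e) + w0 * excess (\<lambda>e. of_bool (e \<in> Z)) s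
      \<le> (\<Sum>e\<in>arcs G. w e * \<phi> e) + w0 * excess \<phi> s"
proof -
  text \<open>\<open>None\<close> is a return arc from \<open>t\<close> to \<open>s\<close>, which turns flows into circulations.\<close>
  define A where "A = insert None (Some ` arcs G)"
  define src where "src = case_option t (tail G)"
  define dst where "dst = case_option s (head G)"
  define c where "c = case_option w0 w"
  have A: "finite A" by (simp add: A_def)
  have sumA: "(\<Sum>e\<in>A. f e) = f None + (\<Sum>e\<in>arcs G. f (Some e))" for f :: "'b option \<Rightarrow> real"
    by (simp add: A_def sum.reindex)
  have net: "net_out src dst A x v = (of_bool (t = v) - of_bool (s = v)) * x None +
      excess (\<lambda>e. x (Some e)) v" for x v
    unfolding net_out_def sumA by (simp add: src_def dst_def)
  define x where "x = case_option (excess \<phi> s) \<phi>"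
  have "net_out src dst A x v = 0" for v
  proof -
    have "v \<noteq> s \<Longrightarrow> v \<noteq> t \<Longrightarrow> excess \<phi> v = 0"
      using assms(2) excess_outside_verts by (cases "v \<in> verts G") (auto simp: flow_on_def)
    then show ?thesis using excess_sink[OF assms(2)] s_neq_t by (auto simp: net x_def)
  qed
  from circulation_rounding[OF A this, of c] obtain y :: "'b option \<Rightarrow> real" where
    y: "\<And>v. net_out src dst A y v = 0"
      "\<And>e. e \<in> A \<Longrightarrow> y e \<in> \<int> \<and> \<lfloor>x e\<rfloor> \<le> y e \<and> y e \<le> \<lceil>x e\<rceil>"
      "(\<Sum>e\<in>A. c e * y e) \<le> (\<Sum>e\<in>A. c e * x e)"
    by blast
  define Z where "Z = {e \<in> arcs G. y (Some e) = 1}"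
  let ?z = "\<lambda>e. of_bool (e \<in> Z) :: real"
  let ?v = "excess ?z s"
  have "(y (Some e) = 0 \<or> y (Some e) = 1) \<and> (e \<notin> X \<longrightarrow> y (Some e) = 0)" if e: "e \<in> arcs G" for e
  proof -
    have *: "y (Some e) \<in> \<int>" "\<lfloor>\<phi> e\<rfloor> \<le> y (Some e)" "y (Some e) \<le> \<lceil>\<phi> e\<rceil>"
      using y(2)[of "Some e"] e by (auto simp: A_def x_def)
    from *(1) obtain n where n: "y (Some e) = of_int n" by (auto elim: Ints_cases)
    have "0 \<le> \<lfloor>\<phi> e\<rfloor>" "\<lceil>\<phi> e\<rceil> \<le> 1" using flow_onD[OF assms(2), of e] by (auto simp: ceiling_le_iff)
    with *(2,3) n have "n = 0 \<or> n = 1" by linarith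
    moreover have "n = 0" if "e \<notin> X" using flow_onD(3)[OF assms(2) that] *(2,3) n by simp
    ultimately show ?thesis using n by auto
  qed
  then have 01: "y (Some e) = ?z e" and supp: "e \<notin> X \<Longrightarrow> y (Some e) = 0" if "e \<in> arcs G" for e
    using that by (auto simp: Z_def)
  have "excess (\<lambda>e. y (Some e)) v = excess ?z v" for v
    unfolding net_out_def using 01 by (intro sum.cong) simp_all
  with y(1) have ex: "(of_bool (t = v) - of_bool (s = v)) * y None + excess ?z v = 0" for v
    by (simp add: net)
  from ex[of s] have val: "?v = y None" using s_neq_t by simp
  have "excess ?z v = 0" if "v \<in> verts G - {s, t}" for v
    using ex[of v] that by (cases "v = s"; cases "v = t") auto
  then have flow: "flow_on Z ?z" by (simp add: flow_on_def)
  have "Z \<subseteq> X"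
  proof
    fix e assume "e \<in> Z"
    then have "e \<in> arcs G" "y (Some e) \<noteq> 0" by (auto simp: Z_def)
    with supp show "e \<in> X" by blast
  qed
  moreover note flow
  moreover have "?v \<in> \<int>" "\<lfloor>excess \<phi> s\<rfloor> \<le> ?v" "?v \<le> \<lceil>excess \<phi> s\<rceil>"
    using y(2)[of None] unfolding val by (auto simp: A_def x_def)
  moreover have "(\<Sum>e\<in>Z. w e) + w0 * ?v \<le> (\<Sum>e\<in>arcs G. w e * \<phi> e) + w0 * excess \<phi> s"
  proof -
    have "(\<Sum>e\<in>Z. w e) = (\<Sum>e\<in>arcs G. w e * ?z e)"
      by (intro sum.mono_neutral_cong_left) (auto simp: Z_def)
    also have "\<dots> = (\<Sum>e\<in>arcs G. w e * y (Some e))"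
      using 01 by (intro sum.cong) simp_all
    finally show ?thesis using y(3) by (simp add: sumA c_def x_def val)
  qed
  ultimately show thesis by (rule that)
qed

text \<open>Attainment comes from integrality rather than compactness: a nearly optimal flow is
  rounded to an integral one without losing value.\<close>

lemma max_flow_attained_Ints:
  assumes X: "X \<subseteq> arcs G"
  shows "\<exists>\<phi>. flow_on X \<phi> \<and> excess \<phi> s = mf X \<and> mf X \<in> \<int>"
proof -
  have "flow_on X (\<lambda>_. 0)" by (simp add: flow_on_def net_out_def)
  then have ne: "{\<phi>. flow_on X \<phi>} \<noteq> {}" by blast
  have bdd: "bdd_above ((\<lambda>\<phi>. excess \<phi> s) ` {\<phi>. flow_on X \<phi>})"
    using excess_le_card[OF X] by (intro bdd_aboveI2) auto
  \<comment> \<open>An integer above this threshold is at least \<open>mf X\<close>.\<close>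
  have "real_of_int (\<lceil>mf X\<rceil> - 1) < mf X" by linarith
  then obtain \<phi> where \<phi>: "flow_on X \<phi>" "\<lceil>mf X\<rceil> - 1 < excess \<phi> s"
    using less_cSUP_iff[OF ne bdd, of "\<lceil>mf X\<rceil> - 1"] max_flow_eq_SUP[OF X] by auto
  from flow_rounding[OF X \<phi>(1), of "\<lambda>_. 0" "-1"] obtain Z where
    Z: "Z \<subseteq> X" "flow_on Z (\<lambda>e. of_bool (e \<in> Z))" "excess (\<lambda>e. of_bool (e \<in> Z)) s \<in> \<int>"
      "excess \<phi> s \<le> excess (\<lambda>e. of_bool (e \<in> Z)) s"
    by auto
  let ?v = "excess (\<lambda>e. of_bool (e \<in> Z)) s"
  have flow: "flow_on X (\<lambda>e. of_bool (e \<in> Z))" using Z(2,1) by (rule flow_on_mono)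
  from Z(3) obtain n where n: "?v = of_int n" by (auto elim: Ints_cases)
  with \<phi>(2) Z(4) have "\<lceil>mf X\<rceil> - 1 < n" by linarith
  with n have "mf X \<le> ?v" by linarith
  with excess_le_max_flow[OF X flow] have v: "?v = mf X" by simp
  from Z(3) have "mf X \<in> \<int>" unfolding v .
  with flow v show ?thesis by blast
qed

lemma max_flow_attained:
  assumes "X \<subseteq> arcs G"
  obtains \<phi> where "flow_on X \<phi>" "excess \<phi> s = mf X"
  using max_flow_attained_Ints[OF assms] by blast

lemma max_flow_Ints: "X \<subseteq> arcs G \<Longrightarrow> mf X \<in> \<int>"
  using max_flow_attained_Ints by blast

lemma max_flow_mono:
  assumes "X \<subseteq> Y" "Y \<subseteq> arcs G"
  shows "mf X \<le> mf Y"
proof -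
  have "X \<subseteq> arcs G" using assms by blast
  then obtain \<phi> where \<phi>: "flow_on X \<phi>" "excess \<phi> s = mf X" by (rule max_flow_attained)
  from excess_le_max_flow[OF assms(2) flow_on_mono[OF \<phi>(1) assms(1)]] \<phi>(2) show ?thesis by simp
qed

lemma max_flow_empty: "mf {} = 0"
proof -
  obtain \<phi> where \<phi>: "flow_on {} \<phi>" "excess \<phi> s = mf {}" by (rule max_flow_attained[OF empty_subsetI])
  from flow_onD(3)[OF \<phi>(1)] have "excess \<phi> s = 0" by (simp add: net_out_def)
  with \<phi>(2) show ?thesis by simp
qed

section \<open>Increments\<close>

text \<open>Serves three times: with \<open>Y\<close> the result of one increment of
  \<open>X\<close>, of two successive increments, and of adding a competing set to
  \<open>X\<close>.\<close>

lemma cheap_increment: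
  assumes XY: "X \<subseteq> Y" "Y \<subseteq> arcs G" and gain: "mf X + 1 \<le> mf Y"
  obtains D where "increment G s t X D" "real (card D) * (mf Y - mf X) \<le> card (Y - X)"
proof -
  have X: "X \<subseteq> arcs G" using XY by blast
  obtain \<phi> where \<phi>: "flow_on X \<phi>" "excess \<phi> s = mf X" by (rule max_flow_attained[OF X])
  obtain \<psi> where \<psi>: "flow_on Y \<psi>" "excess \<psi> s = mf Y" by (rule max_flow_attained[OF XY(2)])
  \<comment> \<open>Chosen so that the convex combination has value exactly \<open>mf X + 1\<close>;
    \<open>r \<le> 1\<close> because the gain is at least 1.\<close>
  define r where "r = 1 / (mf Y - mf X)"
  have r: "0 \<le> r" "r \<le> 1" "r * (mf Y - mf X) = 1" using gain by (auto simp: r_def)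
  define \<chi> where "\<chi> e = (1 - r) * \<phi> e + r * \<psi> e" for e
  have \<chi>: "flow_on Y \<chi>"
    unfolding \<chi>_def using flow_on_mono[OF \<phi>(1) XY(1)] \<psi>(1) r(1,2) by (rule flow_on_convex)
  have "excess \<chi> s = mf X + r * (mf Y - mf X)"
    unfolding \<chi>_def net_out_lincomb \<phi> \<psi> by (simp add: algebra_simps)
  then have val: "excess \<chi> s = mf X + 1" using r(3) by simp
  \<comment> \<open>The target value is an integer, so rounding down loses nothing.\<close>
  then have int: "\<lfloor>excess \<chi> s\<rfloor> = excess \<chi> s" using max_flow_Ints[OF X] by auto
  \<comment> \<open>Only arcs outside \<open>X\<close> are charged.\<close>
  obtain Z where Z: "Z \<subseteq> Y" "flow_on Z (\<lambda>e. of_bool (e \<in> Z))"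
      "\<lfloor>excess \<chi> s\<rfloor> \<le> excess (\<lambda>e. of_bool (e \<in> Z)) s"
      "(\<Sum>e\<in>Z. of_bool (e \<notin> X)) \<le> (\<Sum>e\<in>arcs G. of_bool (e \<notin> X) * \<chi> e)"
    using flow_rounding[OF XY(2) \<chi>, of "\<lambda>e. of_bool (e \<notin> X)" 0] by auto
  have fin: "finite Z" "finite Y" using Z(1) XY(2) finite_arcs by (meson finite_subset)+
  let ?D = "Z - X"
  have "flow_on (X \<union> ?D) (\<lambda>e. of_bool (e \<in> Z))" using Z(2) by (rule flow_on_mono) auto
  then have "mf X + 1 \<le> mf (X \<union> ?D)"
    using excess_le_max_flow[of "X \<union> ?D"] Z(1,3) XY int val by fastforce
  then have inc: "increment G s t X ?D" using Z(1) XY by (auto simp: increment_def)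
  have "real (card ?D) = (\<Sum>e\<in>Z. of_bool (e \<notin> X))"
    using fin by (simp add: of_bool_def sum.If_cases Diff_eq Int_def)
  also have "\<dots> \<le> (\<Sum>e\<in>arcs G. of_bool (e \<notin> X) * \<chi> e)" by (rule Z(4))
  \<comment> \<open>Outside \<open>X\<close> the flow \<open>\<phi>\<close> vanishes, so only the
    share \<open>r * \<psi> e\<close> remains.\<close>
  also have "\<dots> \<le> (\<Sum>e\<in>arcs G. r * of_bool (e \<in> Y - X))"
  proof (rule sum_mono)
    fix e
    have "\<psi> e \<le> of_bool (e \<in> Y)" using \<psi>(1) by (simp add: flow_on_def)
    then show "of_bool (e \<notin> X) * \<chi> e \<le> r * of_bool (e \<in> Y - X)"
      using flow_onD(3)[OF \<phi>(1), of e] r(1) mult_left_mono[of "\<psi> e" "of_bool (e \<in> Y)" r]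
      by (cases "e \<in> X") (auto simp: \<chi>_def)
  qed
  also have "\<dots> = r * (\<Sum>e\<in>Y - X. 1)"
    unfolding sum_distrib_left[symmetric] using XY(2)
    by (intro arg_cong2[of r r _ _ "(*)"] sum.mono_neutral_cong_right) auto
  finally have "real (card ?D) \<le> r * card (Y - X)" by simp
  then have "real (card ?D) * (mf Y - mf X) \<le> r * card (Y - X) * (mf Y - mf X)"
    using gain by (intro mult_right_mono) auto
  also have "\<dots> = card (Y - X)" using r(3) by (simp add: mult.assoc mult.commute)
  finally show ?thesis using inc that by blast
qed

section \<open>Paths and positive flow values\<close>

lemma net_out_trail:
  "trail u p v \<Longrightarrow> net_out (tail G) (head G) (set p) (\<lambda>_. 1) w = of_bool (u = w) - of_bool (v = w)"
proof (induction p arbitrary: u)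
  case Nil
  then show ?case by (simp add: trail_Nil_iff net_out_def)
next
  case (Cons e p)
  \<comment> \<open>The arcs of a trail are distinct, so \<open>e\<close> is not in
    \<open>set p\<close> and adds its own term; the sum telescopes.\<close>
  then show ?case by (fastforce simp: trail_Cons_iff net_out_def)
qed

lemma apath_imp_trail: "apath u p v \<Longrightarrow> trail u p v"
  by (auto simp: apath_def trail_def intro: distinct_verts_imp_distinct)

lemma max_flow_apath:
  assumes "apath s p t"
  shows "1 \<le> mf (set p)"
proof -
  have p: "trail s p t" using assms by (rule apath_imp_trail)
  then have sub: "set p \<subseteq> arcs G" by (auto simp: trail_def)
  let ?\<phi> = "\<lambda>e. of_bool (e \<in> set p)"
  have ex: "excess ?\<phi> v = of_bool (s = v) - of_bool (t = v)" for v
    using net_out_restrict[OF sub, of "\<lambda>_. 1" v] net_out_trail[OF p, of v] by simp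
  then have "flow_on (set p) ?\<phi>" by (auto simp: flow_on_def)
  from excess_le_max_flow[OF sub this] ex[of s] s_neq_t show ?thesis by simp
qed

text \<open>Let \<open>R\<close> be the vertices reachable from \<open>s\<close> through
  \<open>S\<close>. No arc of \<open>S\<close> leaves \<open>R\<close>, so the net flow out of
  \<open>R\<close> is at most 0; if \<open>t\<close> were outside \<open>R\<close>, it would equal
  \<open>mf S\<close>.\<close>

lemma ex_apath_of_max_flow_pos:
  assumes S: "S \<subseteq> arcs G" and pos: "0 < mf S"
  obtains p where "apath s p t" "set p \<subseteq> S"
proof -
  define R where "R = {v. \<exists>p. awalk s p v \<and> set p \<subseteq> S}"
  have RV: "R \<subseteq> verts G" by (auto simp: R_def)
  then have R: "finite R" by (rule finite_subset) simp
  have sR: "s \<in> R" using s_in_verts by (auto simp: R_def awalk_Nil_iff intro!: exI[of _ "[]"])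
  have closed: "head G e \<in> R" if "e \<in> S" "tail G e \<in> R" for e
  proof -
    from that obtain p where "awalk s p (tail G e)" "set p \<subseteq> S" by (auto simp: R_def)
    moreover have "awalk (tail G e) [e] (head G e)" using that S by (auto intro: arc_implies_awalk)
    ultimately have "awalk s (p @ [e]) (head G e)" "set (p @ [e]) \<subseteq> S"
      using that(1) by (auto intro: awalk_appendI simp del: awalk_append_iff)
    then show ?thesis unfolding R_def by blast
  qed
  have "t \<in> R"
  proof (rule ccontr)
    assume t: "t \<notin> R"
    obtain \<phi> where \<phi>: "flow_on S \<phi>" "excess \<phi> s = mf S" by (rule max_flow_attained[OF S])
    have "mf S = (\<Sum>v\<in>{s}. excess \<phi> v)" using \<phi> by simp
    also have "\<dots> = (\<Sum>v\<in>R. excess \<phi> v)"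
      using R sR t RV \<phi>(1) by (intro sum.mono_neutral_left) (auto simp: flow_on_def)
    also have "\<dots> = (\<Sum>e\<in>arcs G. (of_bool (tail G e \<in> R) - of_bool (head G e \<in> R)) * \<phi> e)"
      by (rule sum_net_out[OF R])
    also have "\<dots> \<le> 0"
    proof (rule sum_nonpos)
      fix e
      show "(of_bool (tail G e \<in> R) - of_bool (head G e \<in> R)) * \<phi> e \<le> 0"
        using closed[of e] flow_onD[OF \<phi>(1), of e] by (cases "e \<in> S") (auto simp: of_bool_def)
    qed
    finally show False using pos by simp
  qed
  then obtain p where p: "awalk s p t" "set p \<subseteq> S" by (auto simp: R_def)
  with apath_awalk_to_apath[OF p(1)] awalk_to_apath_subset[OF p(1)] that show thesis by blast
qed

text \<open>Makes the initial path an ordinary quickest increment, so that both rules of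
  \<open>qi_run\<close> are handled alike. It is smallest because every increment of the empty set
  contains an \<open>s\<close>-\<open>t\<close>-path.\<close>

lemma quickest_increment_shortest_path:
  assumes "shortest_path G s t p"
  shows "quickest_increment G s t {} (set p)"
proof -
  have p: "apath s p t" "\<And>q. apath s q t \<Longrightarrow> length p \<le> length q"
    using assms by (auto simp: shortest_path_def)
  have "set p \<subseteq> arcs G" using p(1) by (auto simp: apath_def)
  with max_flow_apath[OF p(1)] have "increment G s t {} (set p)"
    by (simp add: increment_def max_flow_empty)
  moreover have "card (set p) \<le> card D" if "increment G s t {} D" for D
  proof -
    have D: "D \<subseteq> arcs G" "0 < mf D" using that by (auto simp: increment_def max_flow_empty)
    then obtain q where q: "apath s q t" "set q \<subseteq> D" by (rule ex_apath_of_max_flow_pos)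
    have "card (set p) \<le> length p" by (rule card_length)
    also have "\<dots> \<le> length q" using p(2) q(1) .
    also have "\<dots> = card (set q)"
      using apath_imp_trail[OF q(1)] by (simp add: trail_def distinct_card)
    also have "\<dots> \<le> card D" using q(2) D(1) by (meson card_mono finite_arcs finite_subset)
    finally show ?thesis .
  qed
  ultimately show ?thesis by (simp add: quickest_increment_def)
qed

section \<open>Invariant of the run\<close>

text \<open>The witness for \<open>d\<close> is the size of the last increment.\<close>

definition competitive_prefix :: "'b list \<Rightarrow> bool" where
  "competitive_prefix xs \<longleftrightarrow> set xs \<subseteq> arcs G \<and>
    (\<forall>S. S \<subseteq> arcs G \<and> card S < length xs \<longrightarrow> mf S \<le> 2 * mf (set (take (card S) xs))) \<and>
    (\<exists>d. length xs \<le> mf (set xs) * real d \<and> (\<forall>D. increment G s t (set xs) D \<longrightarrow> d \<le> card D))"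

text \<open>A gain \<open>m > 1\<close> would, by \<open>cheap_increment\<close>, yield an increment
  with at most \<open>card D / m\<close> arcs, fewer than the minimum.\<close>

lemma max_flow_quickest_increment:
  assumes X: "X \<subseteq> arcs G" and D: "quickest_increment G s t X D"
  shows "mf (X \<union> D) = mf X + 1"
proof (rule ccontr)
  assume neq: "mf (X \<union> D) \<noteq> mf X + 1"
  have D': "D \<subseteq> arcs G - X" "mf X + 1 \<le> mf (X \<union> D)"
    using D by (auto simp: quickest_increment_def increment_def)
  then have XD: "X \<union> D \<subseteq> arcs G" "X \<union> D - X = D" using X by auto
  have "D \<noteq> {}" using D'(2) by auto
  then have pos: "0 < card D" using D'(1) by (meson card_gt_0_iff finite_Diff finite_arcs finite_subset)
  obtain C where C: "increment G s t X C" "real (card C) * (mf (X \<union> D) - mf X) \<le> card D"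
    using cheap_increment[OF _ XD(1) D'(2)] XD(2) by auto
  have "card D \<le> card C" using D C(1) by (simp add: quickest_increment_def)
  with pos neq D'(2) have "real (card D) * 1 < real (card C) * (mf (X \<union> D) - mf X)"
    by (intro mult_le_less_imp_less) auto
  with C(2) show False by simp
qed

lemma competitive_prefix_Nil: "competitive_prefix []"
  by (auto simp: competitive_prefix_def max_flow_empty)

text \<open>Only sets \<open>S\<close> with \<open>length xs \<le> card S\<close> are new. They are
  compared with \<open>set xs\<close>, which the prefix of length \<open>card S\<close>
  contains.\<close>

lemma competitive_prefix_append:
  assumes xs: "competitive_prefix xs" and D: "quickest_increment G s t (set xs) (set ds)"
    and ds: "distinct ds"
  shows "competitive_prefix (xs @ ds)"
proof -
  let ?X = "set xs" and ?D = "set ds"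
  have X: "?X \<subseteq> arcs G"
    and old: "\<And>S. S \<subseteq> arcs G \<Longrightarrow> card S < length xs \<Longrightarrow> mf S \<le> 2 * mf (set (take (card S) xs))"
    using xs by (auto simp: competitive_prefix_def)
  obtain d where d: "length xs \<le> mf ?X * real d" "\<And>D. increment G s t ?X D \<Longrightarrow> d \<le> card D"
    using xs by (auto simp: competitive_prefix_def)
  have inc: "increment G s t ?X ?D" and min: "\<And>C. increment G s t ?X C \<Longrightarrow> card ?D \<le> card C"
    using D by (auto simp: quickest_increment_def)
  have XD: "?X \<union> ?D \<subseteq> arcs G" using X inc by (auto simp: increment_def)
  have mfXD: "mf (?X \<union> ?D) = mf ?X + 1" by (rule max_flow_quickest_increment[OF X D])
  have mf0: "0 \<le> mf ?X" using max_flow_mono[OF _ X, of "{}"] by (simp add: max_flow_empty)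
  \<comment> \<open>The old witness \<open>d\<close> bounds every increment of \<open>?X\<close>
    from below, hence \<open>d \<le> card ?D\<close>, and all earlier arcs can be charged at the new
    rate \<open>card ?D\<close>.\<close>
  have len: "length (xs @ ds) \<le> (mf ?X + 1) * card ?D"
  proof -
    have "mf ?X * real d \<le> mf ?X * card ?D" using d(2)[OF inc] mf0 by (intro mult_left_mono) auto
    with d(1) show ?thesis by (simp add: distinct_card[OF ds] algebra_simps)
  qed
  have "mf S \<le> 2 * mf (set (take (card S) (xs @ ds)))"
    if S: "S \<subseteq> arcs G" "card S < length (xs @ ds)" for S
  proof (cases "card S < length xs")
    case True
    with old[OF S(1)] show ?thesis by simp
  next
    case False
    have "mf S \<le> 2 * mf ?X"
    proof (rule ccontr)
      assume "\<not> mf S \<le> 2 * mf ?X"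
      moreover obtain m n where mn: "mf S = of_int m" "mf ?X = of_int n"
        using max_flow_Ints S(1) X by (metis Ints_cases)
      ultimately have "real_of_int (2 * n) < of_int m" by simp
      \<comment> \<open>Integrality sharpens the strict inequality by one, which gives the gain
        \<open>mf ?X + 1\<close> that matches \<open>len\<close>.\<close>
      then have "real_of_int (2 * n + 1) \<le> of_int m" by (simp only: of_int_less_iff of_int_le_iff)
      then have "2 * mf ?X + 1 \<le> mf S" using mn by simp
      moreover have XS: "?X \<union> S \<subseteq> arcs G" using X S(1) by blast
      ultimately have gain: "mf ?X + 1 \<le> mf (?X \<union> S) - mf ?X"
        using max_flow_mono[of S "?X \<union> S"] by auto
      obtain C where C: "increment G s t ?X C"
        "real (card C) * (mf (?X \<union> S) - mf ?X) \<le> card (?X \<union> S - ?X)"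
        using cheap_increment[OF _ XS, of ?X] gain mf0 by auto
      have "real (card ?D) * (mf ?X + 1) \<le> real (card C) * (mf (?X \<union> S) - mf ?X)"
        using min[OF C(1)] gain mf0 by (intro mult_mono) auto
      also have "\<dots> \<le> card (?X \<union> S - ?X)" by (rule C(2))
      also have "\<dots> \<le> card S"
        using finite_subset[OF S(1) finite_arcs] by (auto intro: card_mono)
      also have "\<dots> < length (xs @ ds)" using S(2) by simp
      finally show False using len by (simp add: mult.commute)
    qed
    also have "?X \<subseteq> set (take (card S) (xs @ ds))" using False by auto
    then have "mf ?X \<le> mf (set (take (card S) (xs @ ds)))"
      using XD by (intro max_flow_mono) (auto dest: in_set_takeD)
    finally show ?thesis by simp
  qed
  \<comment> \<open>\<open>card ?D\<close> is the new witness: \<open>?D\<close> and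
    \<open>C\<close> together gain at least 2 over \<open>?X\<close>, so half of
    \<open>card (?D \<union> C)\<close> is no less than \<open>card ?D\<close>.\<close>
  moreover have "card ?D \<le> card C" if C: "increment G s t (?X \<union> ?D) C" for C
  proof -
    have XDC: "?X \<union> (?D \<union> C) \<subseteq> arcs G" and gain: "2 \<le> mf (?X \<union> (?D \<union> C)) - mf ?X"
      using C XD mfXD by (auto simp: increment_def Un_assoc)
    obtain B where B: "increment G s t ?X B"
      "real (card B) * (mf (?X \<union> (?D \<union> C)) - mf ?X) \<le> card (?X \<union> (?D \<union> C) - ?X)"
      using cheap_increment[OF _ XDC, of ?X] gain by auto
    have "real (card ?D) * 2 \<le> real (card B) * (mf (?X \<union> (?D \<union> C)) - mf ?X)"
      using min[OF B(1)] gain by (intro mult_mono) auto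
    also have "\<dots> \<le> card (?X \<union> (?D \<union> C) - ?X)" by (rule B(2))
    also have "\<dots> \<le> card (?D \<union> C)"
      using finite_subset[OF XDC finite_arcs] by (auto intro!: card_mono)
    also have "\<dots> \<le> real (card ?D) + card C" using card_Un_le[of ?D C] by linarith
    finally show ?thesis by simp
  qed
  ultimately show ?thesis
    unfolding competitive_prefix_def using XD len mfXD
    by (auto intro!: exI[of _ "card ?D"])
qed

lemma competitive_prefix_qi_run: "qi_run G s t xs \<Longrightarrow> competitive_prefix xs"
proof (induction rule: qi_run.induct)
  case (path p xs)
  with competitive_prefix_append[OF competitive_prefix_Nil, of xs]
  show ?case by (simp add: quickest_increment_shortest_path)
next
  case (increment xs D ds)
  then show ?case by (auto intro: competitive_prefix_append)
qed

text \<open>Sets smaller than the run are covered by the invariant; from there on the prefix already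
  has the maximum flow value of \<open>G\<close>.\<close>

lemma qi_ordering_competitive:
  assumes "qi_ordering G s t es" "S \<subseteq> arcs G" "card S \<le> k"
  shows "mf S \<le> 2 * mf (set (take k es))"
proof -
  obtain xs ys where es: "es = xs @ ys" "set es = arcs G" and run: "qi_run G s t xs"
    and max: "mf (set xs) = mf (arcs G)"
    using assms(1) by (auto simp: qi_ordering_def)
  \<comment> \<open>\<open>S\<close> may have fewer than \<open>k\<close> arcs; it is compared with
    the prefix of length \<open>card S\<close> first, and monotonicity then leads to
    \<open>k\<close>.\<close>
  have "mf S \<le> 2 * mf (set (take (card S) es))"
  proof (cases "card S < length xs")
    case True
    with competitive_prefix_qi_run[OF run] assms(2) es(1) show ?thesis
      by (simp add: competitive_prefix_def)
  next
    case False
    have "mf S \<le> mf (set xs)" unfolding max using assms(2) by (intro max_flow_mono) auto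
    also have "mf (set xs) \<le> mf (set (take (card S) es))"
      using False es by (intro max_flow_mono) (auto dest: in_set_takeD)
    \<comment> \<open>Nonnegativity of the flow value weakens factor 1 to factor 2.\<close>
    finally show ?thesis
      using max_flow_mono[of "{}" "set (take (card S) es)"] es(2) set_take_subset[of "card S" es]
      by (simp add: max_flow_empty)
  qed
  also have "mf (set (take (card S) es)) \<le> mf (set (take k es))"
    using assms(3) es(2) by (intro max_flow_mono set_take_subset_set_take) (auto dest: in_set_takeD)
  finally show ?thesis by simp
qed

end

theorem theorem4:
  fixes G :: "('a, 'b) pre_digraph" and s t :: 'a and es :: "'b list"
  assumes "fin_digraph G"
    and "s \<in> verts G" and "t \<in> verts G" and "s \<noteq> t"
    and "s \<rightarrow>\<^sup>*\<^bsub>G\<^esub> t"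
    and "qi_ordering G s t es"
  shows "\<forall>k \<in> {1..card (arcs G)}. \<forall>S. optimal_set G s t k S \<longrightarrow>
           max_flow G s t S \<le> 2 * max_flow G s t (set (take k es))"
proof -
  interpret fin_digraph G by fact
  interpret st_network G s t by unfold_locales fact+
  show ?thesis using qi_ordering_competitive[OF assms(6)] by (auto simp: optimal_set_def)
qed

end
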